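(* Let $(\mathcal{Q},\mathcal{B})$ be a dissemination quorum system over the set of servers $\mathbf{V}$. Then Bracha broadcast over $(\mathcal{Q},\mathcal{B})$ satisfies the specification of reliable Byzantine broadcast (Validity, No duplication, Integrity, Consistency and Totality) in every execution in which all faulty servers belong to some single element of $\mathcal{B}$, i.e. in which there is $B\in\mathcal{B}$ containing every faulty server.
   Context: System model. There is a set of clients $\mathbf{C}$ and a disjoint finite non-empty set of servers $\mathbf{V}$. In an execution each node (client or server) is either correct (follows its protocol) or faulty (Byzantine: behaves arbitrarily). One distinguished client $c$ is the sender; it may be correct or faulty. Any two nodes communicate over an asynchronous point-to-point channel. If both endpoints are correct, the channel is authenticated and reliable: a correct node receives (eventually, after an arbitrary finite delay) a message from another correct node if and only if the latter sent it. Servers also send messages to themselves. Executions are complete: a handler of a correct server that stays enabled is eventually executed. A correct sender broadcasts at most one value. Quorum systems. A quorum system is a non-empty set $\mathcal{Q}\subseteq 2^{\mathbf{V}}$ such that every $U\in\mathcal{Q}$ is non-empty, any two $U_1,U_2\in\mathcal{Q}$ intersect, and $U_1\cup U_2\in\mathcal{Q}$ for all $U_1,U_2\in\mathcal{Q}$. A fail-prone system is a non-empty set $\mathcal{B}\subseteq 2^{\mathbf{V}}$ none of whose elements is contained in another. A dissemination quorum system (DQS) is a pair $(\mathcal{Q},\mathcal{B})$ of these satisfying D-consistency: $\forall U_1,U_2\in\mathcal{Q}.\ \forall B\in\mathcal{B}.\ U_1\cap U_2\not\subseteq B$; and D-availability: $\forall B\in\mathcal{B}.\ \exists U\in\mathcal{Q}.\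 U\cap B=\emptyset$. Bracha broadcast over $(\mathcal{Q},\mathcal{B})$. To broadcast a value $a$, the sender $c$ sends $\mathtt{BCAST}(a)$ to every server. Each server has Boolean variables echoed, ready, delivered, all initially false, and the following handlers. (1) When it has received $\mathtt{BCAST}(a)$ from $c$ and echoed is false: set echoed to true and send $\mathtt{ECHO}(a)$ to every server. (2) When it has received $\mathtt{ECHO}(a)$ from every $u\in U$ for some $U\in\mathcal{Q}$, and ready is false: set ready to true and send $\mathtt{READY}(a)$ to every server. (3) When it has received $\mathtt{READY}(a)$ from every $u\in B$ for some non-empty $B\subseteq\mathbf{V}$ such that $B\not\subseteq B'$ for all $B'\in\mathcal{B}$, and ready is false: set ready to true and send $\mathtt{READY}(a)$ to every server. (4) When it has received $\mathtt{READY}(a)$ from every $u\in U$ for some $U\in\mathcal{Q}$, and delivered is false: set delivered to true and deliver $a$. Reliable Byzantine broadcast. Validity: if the sender is correct and broadcasts a value $a$, then every correct server eventually delivers $a$. No duplication: every correct server delivers at most one value. Integrity: if some correct server delivers a value $a$ and the sender is correct, then $a$ was previously broadcast by the sender. Consistency: if some correct server delivers $a$ and another correct server delivers $a'$, then $a=a'$. Totality: if a correct server delivers a value, then every correct server eventually delivers a value. *)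

theory Defs
  imports Main
begin

section \<open>Dissemination quorum systems\<close>

definition quorum_system :: "'n set \<Rightarrow> 'n set set \<Rightarrow> bool" where
  "quorum_system V \<Q> \<longleftrightarrow>
     \<Q> \<noteq> {} \<and> \<Q> \<subseteq> Pow V \<and> (\<forall>U\<in>\<Q>. U \<noteq> {}) \<and>
     (\<forall>U\<^sub>1\<in>\<Q>. \<forall>U\<^sub>2\<in>\<Q>. U\<^sub>1 \<inter> U\<^sub>2 \<noteq> {}) \<and>
     (\<forall>U\<^sub>1\<in>\<Q>. \<forall>U\<^sub>2\<in>\<Q>. U\<^sub>1 \<union> U\<^sub>2 \<in> \<Q>)"

definition fail_prone_system :: "'n set \<Rightarrow> 'n set set \<Rightarrow> bool" where
  "fail_prone_system V \<B> \<longleftrightarrow>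
     \<B> \<noteq> {} \<and> \<B> \<subseteq> Pow V \<and> (\<forall>B\<in>\<B>. \<forall>B'\<in>\<B>. B \<subseteq> B' \<longrightarrow> B = B')"

definition D_consistency :: "'n set set \<Rightarrow> 'n set set \<Rightarrow> bool" where
  "D_consistency \<Q> \<B> \<longleftrightarrow> (\<forall>U\<^sub>1\<in>\<Q>. \<forall>U\<^sub>2\<in>\<Q>. \<forall>B\<in>\<B>. \<not> U\<^sub>1 \<inter> U\<^sub>2 \<subseteq> B)"

definition D_availability :: "'n set set \<Rightarrow> 'n set set \<Rightarrow> bool" where
  "D_availability \<Q> \<B> \<longleftrightarrow> (\<forall>B\<in>\<B>. \<exists>U\<in>\<Q>. U \<inter> B = {})"

definition dissemination_quorum_system :: "'n set \<Rightarrow> 'n set set \<Rightarrow> 'n set set \<Rightarrow> bool" where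
  "dissemination_quorum_system V \<Q> \<B> \<longleftrightarrow>
     quorum_system V \<Q> \<and> fail_prone_system V \<B> \<and>
     D_consistency \<Q> \<B> \<and> D_availability \<Q> \<B>"

section \<open>Bracha broadcast\<close>

datatype 'v message = BCAST 'v | ECHO 'v | READY 'v

text \<open>
  The inbox holds the pairs (source, message) received so far, the outbox the
  pairs (destination, message) sent so far. Both only grow at correct nodes. They are
  sets because the protocol only tests whether a message has been received.
\<close>

record ('n, 'v) node_state =
  echoed :: bool
  ready :: bool
  delivered :: bool
  inbox :: "('n \<times> 'v message) set"
  outbox :: "('n \<times> 'v message) set"

type_synonym ('n, 'v) config = "'n \<Rightarrow> ('n, 'v) node_state"

definition initial_node_state :: "('n, 'v) node_state" where
  "initial_node_state =
     \<lparr>echoed = False, ready = False, delivered = False, inbox = {}, outbox = {}\<rparr>"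

definition send_all :: "'n set \<Rightarrow> 'v message \<Rightarrow> ('n, 'v) node_state \<Rightarrow> ('n, 'v) node_state" where
  "send_all V m st = st\<lparr>outbox := outbox st \<union> V \<times> {m}\<rparr>"

definition received_from :: "'n set \<Rightarrow> 'v message \<Rightarrow> ('n, 'v) node_state \<Rightarrow> bool" where
  "received_from U m st \<longleftrightarrow> (\<forall>u\<in>U. (u, m) \<in> inbox st)"

datatype handler = On_Bcast | On_Echo_Quorum | On_Ready_Nonfaulty | On_Ready_Quorum

primrec guard ::
  "'n set \<Rightarrow> 'n set set \<Rightarrow> 'n set set \<Rightarrow> 'n \<Rightarrow> handler \<Rightarrow> 'v \<Rightarrow> ('n, 'v) node_state \<Rightarrow> bool"
where
  "guard V \<Q> \<B> c On_Bcast a st \<longleftrightarrow>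
     (c, BCAST a) \<in> inbox st \<and> \<not> echoed st"
| "guard V \<Q> \<B> c On_Echo_Quorum a st \<longleftrightarrow>
     (\<exists>U\<in>\<Q>. received_from U (ECHO a) st) \<and> \<not> ready st"
| "guard V \<Q> \<B> c On_Ready_Nonfaulty a st \<longleftrightarrow>
     (\<exists>B. B \<noteq> {} \<and> B \<subseteq> V \<and> (\<forall>B'\<in>\<B>. \<not> B \<subseteq> B') \<and> received_from B (READY a) st) \<and> \<not> ready st"
| "guard V \<Q> \<B> c On_Ready_Quorum a st \<longleftrightarrow>
     (\<exists>U\<in>\<Q>. received_from U (READY a) st) \<and> \<not> delivered st"

text \<open>
  The delivery of the value by the last handler is visible as the corresponding action
  of the execution, see \<open>delivers\<close> below.
\<close>

primrec effect ::
  "'n set \<Rightarrow> handler \<Rightarrow> 'v \<Rightarrow> ('n, 'v) node_state \<Rightarrow> ('n, 'v) node_state"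
where
  "effect V On_Bcast a st = send_all V (ECHO a) (st\<lparr>echoed := True\<rparr>)"
| "effect V On_Echo_Quorum a st = send_all V (READY a) (st\<lparr>ready := True\<rparr>)"
| "effect V On_Ready_Nonfaulty a st = send_all V (READY a) (st\<lparr>ready := True\<rparr>)"
| "effect V On_Ready_Quorum a st = st\<lparr>delivered := True\<rparr>"

section \<open>Executions\<close>

text \<open>
  \<open>F\<close> is the set of faulty nodes. \<open>Broadcast\<close>, \<open>Receive\<close> (source, destination, message) and
  \<open>Handle\<close> are steps of correct nodes. In particular \<open>Receive\<close> lets a correct node obtain any
  message at any time over its channel from a faulty node, but only messages actually sent over
  its channel from a correct one. A \<open>Byzantine\<close> step changes the states of faulty nodes
  arbitrarily; it may also change nothing, so that finite executions are covered by infinite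
  ones that end in stuttering.
\<close>

datatype ('n, 'v) action =
    Broadcast 'v
  | Receive 'n 'n "'v message"
  | Handle 'n handler 'v
  | Byzantine

primrec step ::
  "'n set \<Rightarrow> 'n set \<Rightarrow> 'n set set \<Rightarrow> 'n set set \<Rightarrow> 'n \<Rightarrow> 'n set \<Rightarrow>
   ('n, 'v) action \<Rightarrow> ('n, 'v) config \<Rightarrow> ('n, 'v) config \<Rightarrow> bool"
where
  "step C V \<Q> \<B> c F (Broadcast a) s s' \<longleftrightarrow>
     c \<notin> F \<and> s' = s(c := send_all V (BCAST a) (s c))"
| "step C V \<Q> \<B> c F (Receive u v m) s s' \<longleftrightarrow>
     u \<in> C \<union> V \<and> v \<in> (C \<union> V) - F \<and> (u \<in> F \<or> (v, m) \<in> outbox (s u)) \<and>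
     s' = s(v := (s v)\<lparr>inbox := insert (u, m) (inbox (s v))\<rparr>)"
| "step C V \<Q> \<B> c F (Handle v h a) s s' \<longleftrightarrow>
     v \<in> V - F \<and> guard V \<Q> \<B> c h a (s v) \<and> s' = s(v := effect V h a (s v))"
| "step C V \<Q> \<B> c F Byzantine s s' \<longleftrightarrow>
     (\<forall>u\<in>(C \<union> V) - F. s' u = s u)"

text \<open>In state \<open>s i\<close>, action \<open>act i\<close> is performed and leads to state \<open>s (Suc i)\<close>.\<close>

definition bracha_run ::
  "'n set \<Rightarrow> 'n set \<Rightarrow> 'n set set \<Rightarrow> 'n set set \<Rightarrow> 'n \<Rightarrow> 'n set \<Rightarrow>
   (nat \<Rightarrow> ('n, 'v) config) \<Rightarrow> (nat \<Rightarrow> ('n, 'v) action) \<Rightarrow> bool"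
where
  "bracha_run C V \<Q> \<B> c F s act \<longleftrightarrow>
     (\<forall>u\<in>(C \<union> V) - F. s 0 u = initial_node_state) \<and>
     (\<forall>i. step C V \<Q> \<B> c F (act i) (s i) (s (Suc i)))"

definition reliable_channels ::
  "'n set \<Rightarrow> 'n set \<Rightarrow> 'n set \<Rightarrow> (nat \<Rightarrow> ('n, 'v) config) \<Rightarrow> bool"
where
  "reliable_channels C V F s \<longleftrightarrow>
     (\<forall>u\<in>(C \<union> V) - F. \<forall>v\<in>(C \<union> V) - F. \<forall>m i.
        (v, m) \<in> outbox (s i u) \<longrightarrow> (\<exists>j. (u, m) \<in> inbox (s j v)))"

definition complete_execution ::
  "'n set \<Rightarrow> 'n set set \<Rightarrow> 'n set set \<Rightarrow> 'n \<Rightarrow> 'n set \<Rightarrow>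
   (nat \<Rightarrow> ('n, 'v) config) \<Rightarrow> (nat \<Rightarrow> ('n, 'v) action) \<Rightarrow> bool"
where
  "complete_execution V \<Q> \<B> c F s act \<longleftrightarrow>
     (\<forall>v\<in>V - F. \<forall>h i. (\<forall>j\<ge>i. \<exists>a. guard V \<Q> \<B> c h a (s j v)) \<longrightarrow>
        (\<exists>j\<ge>i. \<exists>a. act j = Handle v h a))"

definition broadcasts :: "(nat \<Rightarrow> ('n, 'v) action) \<Rightarrow> nat \<Rightarrow> 'v \<Rightarrow> bool" where
  "broadcasts act i a \<longleftrightarrow> act i = Broadcast a"

definition delivers :: "(nat \<Rightarrow> ('n, 'v) action) \<Rightarrow> nat \<Rightarrow> 'n \<Rightarrow> 'v \<Rightarrow> bool" where
  "delivers act i v a \<longleftrightarrow> act i = Handle v On_Ready_Quorum a"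

definition bracha_execution ::
  "'n set \<Rightarrow> 'n set \<Rightarrow> 'n set set \<Rightarrow> 'n set set \<Rightarrow> 'n \<Rightarrow> 'n set \<Rightarrow>
   (nat \<Rightarrow> ('n, 'v) config) \<Rightarrow> (nat \<Rightarrow> ('n, 'v) action) \<Rightarrow> bool"
where
  "bracha_execution C V \<Q> \<B> c F s act \<longleftrightarrow>
     bracha_run C V \<Q> \<B> c F s act \<and>
     reliable_channels C V F s \<and>
     complete_execution V \<Q> \<B> c F s act \<and>
     (c \<notin> F \<longrightarrow> (\<forall>i j a a'. broadcasts act i a \<and> broadcasts act j a' \<longrightarrow> a = a'))"

section \<open>Reliable Byzantine broadcast\<close>

text \<open>
  The specification only refers to the interface: \<open>bc i a\<close> means that the sender broadcasts
  \<open>a\<close> at time \<open>i\<close>, and \<open>dl i v a\<close> that server \<open>v\<close> delivers \<open>a\<close> at time \<open>i\<close>.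
\<close>

definition validity ::
  "'n set \<Rightarrow> 'n \<Rightarrow> 'n set \<Rightarrow> (nat \<Rightarrow> 'v \<Rightarrow> bool) \<Rightarrow> (nat \<Rightarrow> 'n \<Rightarrow> 'v \<Rightarrow> bool) \<Rightarrow> bool"
where
  "validity V c F bc dl \<longleftrightarrow>
     (c \<notin> F \<longrightarrow> (\<forall>i a. bc i a \<longrightarrow> (\<forall>v\<in>V - F. \<exists>j. dl j v a)))"

definition no_duplication ::
  "'n set \<Rightarrow> 'n set \<Rightarrow> (nat \<Rightarrow> 'n \<Rightarrow> 'v \<Rightarrow> bool) \<Rightarrow> bool"
where
  "no_duplication V F dl \<longleftrightarrow>
     (\<forall>v\<in>V - F. \<forall>i j a a'. dl i v a \<and> dl j v a' \<longrightarrow> i = j \<and> a = a')"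

definition integrity ::
  "'n set \<Rightarrow> 'n \<Rightarrow> 'n set \<Rightarrow> (nat \<Rightarrow> 'v \<Rightarrow> bool) \<Rightarrow> (nat \<Rightarrow> 'n \<Rightarrow> 'v \<Rightarrow> bool) \<Rightarrow> bool"
where
  "integrity V c F bc dl \<longleftrightarrow>
     (\<forall>v\<in>V - F. \<forall>i a. dl i v a \<and> c \<notin> F \<longrightarrow> (\<exists>j<i. bc j a))"

definition consistency ::
  "'n set \<Rightarrow> 'n set \<Rightarrow> (nat \<Rightarrow> 'n \<Rightarrow> 'v \<Rightarrow> bool) \<Rightarrow> bool"
where
  "consistency V F dl \<longleftrightarrow>
     (\<forall>v\<in>V - F. \<forall>v'\<in>V - F. \<forall>i j a a'. dl i v a \<and> dl j v' a' \<longrightarrow> a = a')"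

definition totality ::
  "'n set \<Rightarrow> 'n set \<Rightarrow> (nat \<Rightarrow> 'n \<Rightarrow> 'v \<Rightarrow> bool) \<Rightarrow> bool"
where
  "totality V F dl \<longleftrightarrow>
     (\<forall>v\<in>V - F. \<forall>i a. dl i v a \<longrightarrow> (\<forall>v'\<in>V - F. \<exists>j a'. dl j v' a'))"

definition reliable_byzantine_broadcast ::
  "'n set \<Rightarrow> 'n \<Rightarrow> 'n set \<Rightarrow> (nat \<Rightarrow> 'v \<Rightarrow> bool) \<Rightarrow> (nat \<Rightarrow> 'n \<Rightarrow> 'v \<Rightarrow> bool) \<Rightarrow> bool"
where
  "reliable_byzantine_broadcast V c F bc dl \<longleftrightarrow>
     validity V c F bc dl \<and> no_duplication V F dl \<and> integrity V c F bc dl \<and>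
     consistency V F dl \<and> totality V F dl"

end

theory Submission
  imports Defs
begin

text \<open>
  Let \<open>B \<in> \<B>\<close> contain the faulty servers. By D-consistency any two quorums share a correct
  server, and each correct server echoes one value only, so at most one value is ever backed by
  an echo quorum. The first correct server to send \<open>READY a\<close> must have seen such a quorum, since
  a set outside the fail-prone system contains a correct server; hence all \<open>READY\<close> messages of
  correct servers carry the same value. For totality, let \<open>U\<close> be the quorum behind a delivery
  and \<open>U\<^sub>0\<close> a quorum disjoint from \<open>B\<close>. As \<open>U \<inter> U\<^sub>0 \<subseteq> U - F\<close>, D-consistency shows that the
  correct part of \<open>U\<close> is not contained in any fail-prone set, so its \<open>READY\<close> messages make every
  correct server ready, in particular all of \<open>U\<^sub>0\<close>.
\<close>

section \<open>Handler flags and monotonicity of guards\<close>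

primrec flag :: "handler \<Rightarrow> ('n, 'v) node_state \<Rightarrow> bool" where
  "flag On_Bcast st \<longleftrightarrow> echoed st"
| "flag On_Echo_Quorum st \<longleftrightarrow> ready st"
| "flag On_Ready_Nonfaulty st \<longleftrightarrow> ready st"
| "flag On_Ready_Quorum st \<longleftrightarrow> delivered st"

lemma flag_effect [simp]: "flag h (effect V h a st)"
  by (cases h) (simp_all add: send_all_def)

lemma not_flag_if_guard: "guard V \<Q> \<B> c h a st \<Longrightarrow> \<not> flag h st"
  by (cases h) auto

lemma received_from_mono:
  "received_from U m st \<Longrightarrow> inbox st \<subseteq> inbox st' \<Longrightarrow> received_from U m st'"
  by (auto simp: received_from_def)

text \<open>Guards are monotone in the inbox apart from the negated \<open>flag\<close>. Since
  inboxes only grow, an enabled handler stays enabled until that flag is set.\<close>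

lemma guard_mono:
  assumes "guard V \<Q> \<B> c h a st" "inbox st \<subseteq> inbox st'" "\<not> flag h st'"
  shows "guard V \<Q> \<B> c h a st'"
  using assms by (cases h) (auto intro: received_from_mono)

locale bracha =
  fixes C V F B :: "'n set" and c :: 'n
    and \<Q> \<B> :: "'n set set"
    and s :: "nat \<Rightarrow> ('n, 'v) config" and act :: "nat \<Rightarrow> ('n, 'v) action"
  assumes disjoint: "C \<inter> V = {}" and finite_servers: "finite V" and sender: "c \<in> C"
    and dqs: "dissemination_quorum_system V \<Q> \<B>"
    and execution: "bracha_execution C V \<Q> \<B> c F s act"
    and fail_prone: "B \<in> \<B>" and faulty_servers: "F \<inter> V \<subseteq> B"
begin

section \<open>Correct members of quorums\<close>

lemma quorum_subset: "U \<in> \<Q> \<Longrightarrow> U \<subseteq> V"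
  using dqs by (auto simp: dissemination_quorum_system_def quorum_system_def)

lemma quorums_not_fail_prone: "U \<in> \<Q> \<Longrightarrow> U' \<in> \<Q> \<Longrightarrow> B' \<in> \<B> \<Longrightarrow> \<not> U \<inter> U' \<subseteq> B'"
  using dqs by (auto simp: dissemination_quorum_system_def D_consistency_def)

lemma quorums_share_correct:
  assumes "U \<in> \<Q>" "U' \<in> \<Q>"
  obtains u where "u \<in> U" "u \<in> U'" "u \<in> V - F"
proof -
  obtain u where "u \<in> U \<inter> U'" "u \<notin> B"
    using quorums_not_fail_prone[OF assms fail_prone] by auto
  with that quorum_subset[OF assms(1)] faulty_servers show thesis by blast
qed

lemma correct_quorum:
  obtains U where "U \<in> \<Q>" "U \<subseteq> V - F"
proof -
  obtain U where "U \<in> \<Q>" "U \<inter> B = {}"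
    using dqs fail_prone by (auto simp: dissemination_quorum_system_def D_availability_def)
  with that quorum_subset faulty_servers show thesis by blast
qed

text \<open>Lets the correct members of a quorum trigger \<open>On_Ready_Nonfaulty\<close> on their
  own, whatever its faulty members do.\<close>

lemma correct_part_of_quorum_not_fail_prone:
  assumes "U \<in> \<Q>" "B' \<in> \<B>"
  shows "\<not> U - F \<subseteq> B'"
proof -
  obtain U0 where "U0 \<in> \<Q>" "U0 \<subseteq> V - F" by (rule correct_quorum)
  then show ?thesis using quorums_not_fail_prone[OF assms(1) _ assms(2), of U0] by blast
qed

section \<open>Local view of steps and growth of node states\<close>

lemma initial: "u \<in> (C \<union> V) - F \<Longrightarrow> s 0 u = initial_node_state"
  and run_step: "step C V \<Q> \<B> c F (act i) (s i) (s (Suc i))"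
  using execution by (auto simp: bracha_execution_def bracha_run_def)

text \<open>Reduces a global step to its effect on one correct node, so that invariants are proved
  node by node. Steps that concern other nodes, including \<open>Byzantine\<close> ones, fall under
  \<open>idle\<close>.\<close>

lemma step_cases:
  assumes "u \<in> (C \<union> V) - F"
  obtains (idle) "s (Suc i) u = s i u"
  | (bcast) a where "u = c" "act i = Broadcast a"
      "s (Suc i) u = send_all V (BCAST a) (s i u)"
  | (receive) w m where "w \<in> C \<union> V" "w \<in> F \<or> (u, m) \<in> outbox (s i w)"
      "s (Suc i) u = (s i u)\<lparr>inbox := insert (w, m) (inbox (s i u))\<rparr>"
  | (handle) h a where "u \<in> V" "act i = Handle u h a" "guard V \<Q> \<B> c h a (s i u)"
      "s (Suc i) u = effect V h a (s i u)"
proof (cases "act i")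
  case (Broadcast a)
  with run_step[of i] idle bcast[of a] show thesis by (cases "u = c") simp_all
next
  case (Receive w v m)
  with run_step[of i] idle receive[of w m] show thesis by (cases "u = v") auto
next
  case (Handle v h a)
  with run_step[of i] idle handle[of h a] show thesis by (cases "u = v") simp_all
next
  case Byzantine
  with run_step[of i] idle assms show thesis by simp
qed

lemma handle_step:
  assumes "v \<in> V - F" "act i = Handle v h a"
  shows "guard V \<Q> \<B> c h a (s i v)" "s (Suc i) v = effect V h a (s i v)"
  using run_step[of i] assms by auto

lemma node_mono_Suc:
  assumes "u \<in> (C \<union> V) - F"
  shows "inbox (s i u) \<subseteq> inbox (s (Suc i) u)" (is ?in)
    and "outbox (s i u) \<subseteq> outbox (s (Suc i) u)" (is ?out)
    and "flag h (s i u) \<longrightarrow> flag h (s (Suc i) u)" (is ?flag)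
proof -
  have "?in \<and> ?out \<and> ?flag"
    using assms
  proof (cases rule: step_cases[of u i])
    case (bcast a)
    then show ?thesis by (cases h) (auto simp: send_all_def)
  next
    case (receive w m)
    then show ?thesis by (cases h) auto
  next
    case (handle h' a)
    then show ?thesis by (cases h'; cases h) (auto simp: send_all_def)
  qed simp
  then show ?in ?out ?flag by simp_all
qed

lemma inbox_mono: "u \<in> (C \<union> V) - F \<Longrightarrow> i \<le> j \<Longrightarrow> inbox (s i u) \<subseteq> inbox (s j u)"
  using node_mono_Suc(1)[of u] by (rule lift_Suc_mono_le[of "\<lambda>i. inbox (s i u)"])

lemma outbox_mono: "u \<in> (C \<union> V) - F \<Longrightarrow> i \<le> j \<Longrightarrow> outbox (s i u) \<subseteq> outbox (s j u)"
  using node_mono_Suc(2)[of u] by (rule lift_Suc_mono_le[of "\<lambda>i. outbox (s i u)"])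

lemma flag_mono: "u \<in> (C \<union> V) - F \<Longrightarrow> i \<le> j \<Longrightarrow> flag h (s i u) \<Longrightarrow> flag h (s j u)"
  \<comment> \<open>Booleans are ordered by implication, so persistence of a flag is monotonicity of
    a sequence.\<close>
  using lift_Suc_mono_le[of "\<lambda>i. flag h (s i u)" i j] node_mono_Suc(3)[of u h]
  by (simp add: le_bool_def)

section \<open>Sent and received messages\<close>

definition sent :: "nat \<Rightarrow> 'n \<Rightarrow> 'v message \<Rightarrow> bool" where
  "sent i u m \<longleftrightarrow> (\<exists>w. (w, m) \<in> outbox (s i u))"

lemma sent_mono: "sent i u m \<Longrightarrow> u \<in> (C \<union> V) - F \<Longrightarrow> i \<le> j \<Longrightarrow> sent j u m"
  using outbox_mono[of u i j] by (auto simp: sent_def)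

text \<open>The outbox of a correct node starts empty and grows only by \<open>send_all\<close>.
  Hence \<open>sent\<close> may forget the destination.\<close>

lemma sent_to_all:
  assumes "u \<in> (C \<union> V) - F" "sent i u m" "v \<in> V"
  shows "(v, m) \<in> outbox (s i u)"
  using assms(2)
proof (induction i)
  case 0
  then show ?case using assms(1) by (simp add: sent_def initial initial_node_state_def)
next
  case (Suc i)
  from assms(1) show ?case
  proof (cases rule: step_cases[of u i])
    case (handle h a)
    with Suc assms(3) show ?thesis by (cases h) (auto simp: sent_def send_all_def)
  qed (use Suc assms(3) in \<open>auto simp: sent_def send_all_def\<close>)
qed

text \<open>Authenticity: the inbox of a correct node grows only by \<open>Receive\<close>, which
  for a correct source requires the message in its outbox.\<close>

lemma inbox_sent:
  assumes "u \<in> (C \<union> V) - F" "v \<in> (C \<union> V) - F" "(u, m) \<in> inbox (s i v)"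
  shows "sent i u m"
  using assms(3)
proof (induction i)
  case 0
  then show ?case using assms(2) by (simp add: initial initial_node_state_def)
next
  case (Suc i)
  have *: "sent (Suc i) u m" if "sent i u m"
    using that assms(1) by (rule sent_mono) simp
  from assms(2) show ?case
  proof (cases rule: step_cases[of v i])
    case (receive w m')
    with Suc assms(1) * show ?thesis by (auto simp: sent_def)
  next
    case (handle h a)
    with Suc * show ?thesis by (cases h) (auto simp: send_all_def)
  qed (use Suc * in \<open>auto simp: send_all_def\<close>)
qed

lemma received_from_sent:
  assumes "received_from U m (s i v)" "v \<in> V - F" "u \<in> U" "u \<in> V - F"
  shows "sent i u m"
  using assms inbox_sent[of u v m i] by (auto simp: received_from_def)

section \<open>Eventual reception and eventual execution\<close>

lemma eventually_received:
  assumes "u \<in> (C \<union> V) - F" "sent i u m" "v \<in> V - F"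
  shows "\<exists>j. (u, m) \<in> inbox (s j v)"
proof -
  have "reliable_channels C V F s" using execution by (simp add: bracha_execution_def)
  moreover have "(v, m) \<in> outbox (s i u)" using sent_to_all assms by simp
  ultimately show ?thesis using assms unfolding reliable_channels_def by blast
qed

lemma eventually_received_from:
  assumes "U \<subseteq> V - F" "\<And>u. u \<in> U \<Longrightarrow> \<exists>i. sent i u m" "v \<in> V - F"
  shows "\<exists>j. received_from U m (s j v)"
proof -
  have "\<forall>u\<in>U. \<exists>j. (u, m) \<in> inbox (s j v)"
    using eventually_received[OF _ _ assms(3)] assms(1,2) by blast
  then obtain t where t: "\<And>u. u \<in> U \<Longrightarrow> (u, m) \<in> inbox (s (t u) v)" by metis
  \<comment> \<open>By finiteness, everything has arrived at the latest of the times
    \<open>t u\<close>. For empty \<open>U\<close> the maximum is arbitrary and the claim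
    vacuous.\<close>
  have "finite U" using assms(1) finite_servers finite_subset by blast
  then have "inbox (s (t u) v) \<subseteq> inbox (s (Max (t ` U)) v)" if "u \<in> U" for u
    using that assms(3) by (intro inbox_mono) auto
  then show ?thesis using t unfolding received_from_def by blast
qed

text \<open>If the flag were never set, the guard would hold forever and completeness would run the
  handler, which sets the flag. The handler may run with a value other than \<open>a\<close>, so
  only the flag can be concluded.\<close>

lemma eventually_flag:
  assumes v: "v \<in> V - F" and trigger: "\<not> flag h (s i v) \<Longrightarrow> guard V \<Q> \<B> c h a (s i v)"
  shows "\<exists>j. flag h (s j v)"
proof (rule ccontr)
  assume never: "\<not> (\<exists>j. flag h (s j v))"
  have "guard V \<Q> \<B> c h a (s j v)" if "i \<le> j" for j
    using trigger never inbox_mono[OF _ that, of v] v by (auto intro: guard_mono)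
  moreover have "complete_execution V \<Q> \<B> c F s act"
    using execution by (simp add: bracha_execution_def)
  ultimately obtain j a' where "act j = Handle v h a'"
    using v unfolding complete_execution_def by blast
  from handle_step(2)[OF v this] have "flag h (s (Suc j) v)" by simp
  with never show False by blast
qed

section \<open>Origin and uniqueness of values\<close>

lemma sent_BCAST:
  assumes "c \<notin> F" "sent i c (BCAST a)"
  shows "\<exists>j<i. act j = Broadcast a"
  using assms(2)
proof (induction i)
  case 0
  then show ?case using assms(1) sender by (simp add: sent_def initial initial_node_state_def)
next
  case (Suc i)
  have "c \<in> (C \<union> V) - F" using assms(1) sender by simp
  then have "sent i c (BCAST a) \<or> act i = Broadcast a"
  proof (cases rule: step_cases[of c i])
    case (handle h a)
    then show ?thesis using sender disjoint by blast
  qed (use Suc.prems in \<open>auto simp: sent_def send_all_def\<close>)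
  then show ?case using Suc.IH less_Suc_eq by auto
qed

text \<open>The clauses support each other: \<open>On_Bcast\<close> needs \<open>echoed\<close>
  false, so by the second clause no earlier ECHO exists, which keeps the value unique.\<close>

lemma echo_invariant:
  assumes "v \<in> V - F"
  shows "(echoed (s i v) \<longrightarrow> (\<exists>a. sent i v (ECHO a))) \<and>
    (\<forall>a. sent i v (ECHO a) \<longrightarrow> echoed (s i v) \<and> (c, BCAST a) \<in> inbox (s i v)) \<and>
    (\<forall>a a'. sent i v (ECHO a) \<longrightarrow> sent i v (ECHO a') \<longrightarrow> a = a')"
proof (induction i)
  case 0
  then show ?case using assms by (simp add: sent_def initial initial_node_state_def)
next
  case (Suc i)
  from assms have "v \<in> (C \<union> V) - F" by simp
  then show ?case
  proof (cases rule: step_cases[of v i])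
    case (handle h a)
    with Suc assms show ?thesis by (cases h) (auto simp: sent_def send_all_def)
  qed (use Suc assms in \<open>auto simp: sent_def send_all_def\<close>)
qed

lemma ready_invariant:
  assumes "v \<in> V - F"
  shows "ready (s i v) \<longleftrightarrow> (\<exists>a. sent i v (READY a))"
proof (induction i)
  case 0
  then show ?case using assms by (simp add: sent_def initial initial_node_state_def)
next
  case (Suc i)
  from assms have "v \<in> (C \<union> V) - F" by simp
  then show ?case
  proof (cases rule: step_cases[of v i])
    case (handle h a)
    with Suc assms show ?thesis by (cases h) (auto simp: sent_def send_all_def)
  qed (use Suc assms in \<open>auto simp: sent_def send_all_def\<close>)
qed

text \<open>Induction on time for all servers at once: an echo quorum gives \<open>U\<close>
  directly, while amplification points to a correct server that sent the same READY in an earlier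
  state.\<close>

lemma sent_READY_origin:
  assumes "v \<in> V - F" "sent i v (READY a)"
  shows "\<exists>U\<in>\<Q>. \<forall>u\<in>U - F. sent i u (ECHO a)"
  using assms
proof (induction i arbitrary: v)
  case 0
  then show ?case by (simp add: sent_def initial initial_node_state_def)
next
  case (Suc i)
  have lift: "\<exists>U\<in>\<Q>. \<forall>u\<in>U - F. sent (Suc i) u (ECHO a)"
    if "U \<in> \<Q>" "\<forall>u\<in>U - F. sent i u (ECHO a)" for U
    using that quorum_subset[of U] sent_mono[of i _ "ECHO a" "Suc i"] by (intro bexI[of _ U]) auto
  have old: ?case if "w \<in> V - F" "sent i w (READY a)" for w
    using Suc.IH[OF that] lift by blast
  show ?case
  proof (cases "sent i v (READY a)")
    case True
    then show ?thesis using old Suc.prems by blast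
  next
    case False
    have "v \<in> (C \<union> V) - F" using Suc.prems by simp
    then obtain h where h: "h = On_Echo_Quorum \<or> h = On_Ready_Nonfaulty"
      "guard V \<Q> \<B> c h a (s i v)"
    proof (cases rule: step_cases[of v i])
      case (handle h a')
      with False Suc.prems(2) have "(h = On_Echo_Quorum \<or> h = On_Ready_Nonfaulty) \<and> a' = a"
        by (cases h) (auto simp: sent_def send_all_def)
      with handle(3) that show ?thesis by blast
    qed (use False Suc.prems in \<open>auto simp: sent_def send_all_def\<close>)
    from h(1) show ?thesis
    proof
      assume "h = On_Echo_Quorum"
      with h(2) obtain U where U: "U \<in> \<Q>" "received_from U (ECHO a) (s i v)" by auto
      have "\<forall>u\<in>U - F. sent i u (ECHO a)"
        using received_from_sent[OF U(2) Suc.prems(1)] quorum_subset[OF U(1)] by blast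
      with U(1) show ?thesis by (rule lift)
    next
      assume "h = On_Ready_Nonfaulty"
      with h(2) obtain W where W: "W \<subseteq> V" "\<not> W \<subseteq> B" "received_from W (READY a) (s i v)"
        using fail_prone by (simp only: guard.simps) blast
      then obtain w where "w \<in> W" "w \<in> V - F" using faulty_servers by blast
      with old received_from_sent[OF W(3) Suc.prems(1)] show ?thesis by blast
    qed
  qed
qed

lemma sent_READY_unique:
  assumes "v \<in> V - F" "sent i v (READY a)" "v' \<in> V - F" "sent j v' (READY a')"
  shows "a = a'"
proof -
  \<comment> \<open>At the later time both origins refer to one state, where a shared correct server
    would have echoed both values.\<close>
  define k where "k = max i j"
  have "sent k v (READY a)" "sent k v' (READY a')"
    using assms sent_mono[of i v _ k] sent_mono[of j v' _ k] by (auto simp: k_def)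
  then obtain U U' where U: "U \<in> \<Q>" "\<forall>u\<in>U - F. sent k u (ECHO a)"
    "U' \<in> \<Q>" "\<forall>u\<in>U' - F. sent k u (ECHO a')"
    using sent_READY_origin assms(1,3) by meson
  obtain u where "u \<in> U" "u \<in> U'" "u \<in> V - F" using quorums_share_correct[OF U(1,3)] .
  with U echo_invariant[of u k] show ?thesis by blast
qed

text \<open>Traces a READY back through an echo by a correct server to the BCAST of the
  sender.\<close>

lemma sent_READY_broadcast:
  assumes "v \<in> V - F" "sent i v (READY a)" "c \<notin> F"
  shows "\<exists>j<i. act j = Broadcast a"
proof -
  obtain U where U: "U \<in> \<Q>" "\<forall>u\<in>U - F. sent i u (ECHO a)"
    using sent_READY_origin assms(1,2) by blast
  \<comment> \<open>With both quorums equal, the intersection property yields a correct member of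
    \<open>U\<close>.\<close>
  obtain u where "u \<in> U" "u \<in> V - F" using quorums_share_correct[OF U(1) U(1)] .
  then have "(c, BCAST a) \<in> inbox (s i u)" using U echo_invariant[of u i] by blast
  then have "sent i c (BCAST a)"
    using \<open>u \<in> V - F\<close> sender assms(3) by (intro inbox_sent[of c u]) auto
  then show ?thesis using sent_BCAST assms(3) by blast
qed

section \<open>From READY messages to deliveries and back\<close>

lemma delivers_sent_READY:
  assumes "v \<in> V - F" "delivers act i v a"
  obtains U where "U \<in> \<Q>" "\<And>u. u \<in> U - F \<Longrightarrow> sent i u (READY a)"
proof -
  have "guard V \<Q> \<B> c On_Ready_Quorum a (s i v)"
    using handle_step(1)[OF assms(1), of i On_Ready_Quorum a] assms(2) by (simp add: delivers_def)
  then obtain U where U: "U \<in> \<Q>" "received_from U (READY a) (s i v)" by auto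
  show thesis
    using that[OF U(1)] received_from_sent[OF U(2) assms(1)] quorum_subset[OF U(1)] by blast
qed

lemma delivers_sent_READY_by_correct:
  assumes "v \<in> V - F" "delivers act i v a"
  obtains u where "u \<in> V - F" "sent i u (READY a)"
proof -
  obtain U where U: "U \<in> \<Q>" "\<And>u. u \<in> U - F \<Longrightarrow> sent i u (READY a)"
    using delivers_sent_READY[OF assms] by blast
  obtain u where "u \<in> U" "u \<in> V - F" using quorums_share_correct[OF U(1) U(1)] .
  with U(2) that show thesis by blast
qed

lemma delivered_delivers:
  assumes "v \<in> V - F" "delivered (s i v)"
  shows "\<exists>j a. delivers act j v a"
  using assms(2)
proof (induction i)
  case 0
  then show ?case using assms(1) by (simp add: initial initial_node_state_def)
next
  case (Suc i)
  have "v \<in> (C \<union> V) - F" using assms(1) by simp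
  then show ?case
  proof (cases rule: step_cases[of v i])
    case (handle h a)
    with Suc show ?thesis by (cases h) (auto simp: send_all_def delivers_def)
  qed (use Suc in \<open>auto simp: send_all_def\<close>)
qed

text \<open>Common end of validity and totality: all correct servers are ready for the same value,
  so a quorum of correct servers makes \<open>v\<close> deliver.\<close>

lemma all_ready_imp_all_deliver:
  assumes "\<And>u. u \<in> V - F \<Longrightarrow> \<exists>i. ready (s i u)" "v \<in> V - F"
  shows "\<exists>j a. delivers act j v a"
proof -
  obtain i a where "sent i v (READY a)" using assms ready_invariant by blast
  then have all_sent: "\<exists>j. sent j u (READY a)" if "u \<in> V - F" for u
    using assms(1)[OF that] ready_invariant[OF that] sent_READY_unique[OF assms(2) _ that] by blast
  obtain U where U: "U \<in> \<Q>" "U \<subseteq> V - F" by (rule correct_quorum)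
  then obtain j where "received_from U (READY a) (s j v)"
    using eventually_received_from[OF U(2) _ assms(2)] all_sent by blast
  then have "\<exists>j. flag On_Ready_Quorum (s j v)"
    using U(1) assms(2) by (intro eventually_flag[of v _ j a]) auto
  then show ?thesis using delivered_delivers assms(2) by auto
qed

lemma eventually_sent_ECHO:
  assumes "c \<notin> F" "broadcasts act i a" "v \<in> V - F"
  shows "\<exists>j. sent j v (ECHO a)"
proof -
  have "sent (Suc i) c (BCAST a)"
    using run_step[of i] assms by (auto simp: broadcasts_def sent_def send_all_def)
  then obtain j where "(c, BCAST a) \<in> inbox (s j v)"
    using eventually_received[of c] assms(1,3) sender by blast
  then have "\<exists>j. flag On_Bcast (s j v)"
    using assms(3) by (intro eventually_flag[of v _ j a]) auto
  \<comment> \<open>The flag may stem from another value \<open>a'\<close>. That value is traced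
    back to the sender, which broadcasts only one.\<close>
  then obtain k a' where echo: "sent k v (ECHO a')"
    using echo_invariant[OF assms(3)] unfolding flag.simps by blast
  then have "(c, BCAST a') \<in> inbox (s k v)" using echo_invariant[OF assms(3)] by blast
  then have "sent k c (BCAST a')"
    using assms(1,3) sender by (intro inbox_sent[of c v]) auto
  then have "\<exists>j. broadcasts act j a'" using sent_BCAST assms(1) by (auto simp: broadcasts_def)
  then have "a' = a" using execution assms(1,2) unfolding bracha_execution_def by blast
  then show ?thesis using echo by blast
qed

section \<open>The five properties of reliable broadcast\<close>

lemma validity: "validity V c F (broadcasts act) (delivers act)"
  unfolding validity_def
proof (intro impI allI ballI)
  fix i a v assume c: "c \<notin> F" and bc: "broadcasts act i a" and v: "v \<in> V - F"
  obtain U where U: "U \<in> \<Q>" "U \<subseteq> V - F" by (rule correct_quorum)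
  have "\<exists>j. ready (s j u)" if u: "u \<in> V - F" for u
  proof -
    obtain j where "received_from U (ECHO a) (s j u)"
      using eventually_received_from[OF U(2) _ u] eventually_sent_ECHO[OF c bc] U(2) by blast
    then have "\<exists>j. flag On_Echo_Quorum (s j u)"
      using U(1) u by (intro eventually_flag[of u _ j a]) auto
    then show ?thesis by simp
  qed
  \<comment> \<open>Some value \<open>a'\<close> is delivered; its READY origin then identifies it
    with the only broadcast value.\<close>
  then obtain j a' where del: "delivers act j v a'" using all_ready_imp_all_deliver v by blast
  obtain u where "u \<in> V - F" "sent j u (READY a')"
    using delivers_sent_READY_by_correct[OF v del] .
  then have "\<exists>k. broadcasts act k a'" using sent_READY_broadcast c unfolding broadcasts_def by blast
  then have "a' = a" using execution c bc unfolding bracha_execution_def by blast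
  then show "\<exists>j. delivers act j v a" using del by blast
qed

lemma no_duplication: "no_duplication V F (delivers act)"
proof -
  \<comment> \<open>A delivery at \<open>i\<close> sets \<open>delivered\<close> from
    \<open>Suc i\<close> on, which blocks the guard at \<open>j\<close>.\<close>
  have late: False if "v \<in> V - F" "delivers act i v a" "delivers act j v a'" "i < j" for v i j a a'
  proof -
    have "flag On_Ready_Quorum (s (Suc i) v)"
      using handle_step(2)[OF that(1), of i On_Ready_Quorum a] that(2) by (simp add: delivers_def)
    then have "flag On_Ready_Quorum (s j v)"
      using flag_mono[OF _ Suc_leI[OF that(4)]] that(1) by blast
    moreover have "guard V \<Q> \<B> c On_Ready_Quorum a' (s j v)"
      using handle_step(1)[OF that(1), of j On_Ready_Quorum a'] that(3) by (simp add: delivers_def)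
    ultimately show False by (blast dest: not_flag_if_guard)
  qed
  have "i = j \<and> a = a'" if "v \<in> V - F" "delivers act i v a" "delivers act j v a'" for v i j a a'
  proof -
    have "i = j" using late that by (metis linorder_neqE_nat)
    then show ?thesis using that by (simp add: delivers_def)
  qed
  then show ?thesis unfolding no_duplication_def by blast
qed

lemma integrity: "integrity V c F (broadcasts act) (delivers act)"
  unfolding integrity_def broadcasts_def
  by (meson delivers_sent_READY_by_correct sent_READY_broadcast)

lemma consistency: "consistency V F (delivers act)"
  unfolding consistency_def
  by (meson delivers_sent_READY_by_correct sent_READY_unique)

lemma totality: "totality V F (delivers act)"
  unfolding totality_def
proof (intro ballI allI impI)
  fix v i a v' assume v: "v \<in> V - F" "delivers act i v a" and v': "v' \<in> V - F"
  obtain U where U: "U \<in> \<Q>" "\<And>u. u \<in> U - F \<Longrightarrow> sent i u (READY a)"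
    using delivers_sent_READY[OF v] by blast
  \<comment> \<open>The witness is \<open>U - F\<close>, not \<open>U\<close>: faulty members may
    have sent READY to \<open>v\<close> alone.\<close>
  have large: "U - F \<subseteq> V - F" "\<forall>B'\<in>\<B>. \<not> U - F \<subseteq> B'"
    using quorum_subset correct_part_of_quorum_not_fail_prone U(1) by blast+
  \<comment> \<open>The empty set lies inside \<open>B\<close>.\<close>
  then have "U - F \<noteq> {}" using fail_prone by blast
  have "\<exists>j. ready (s j u)" if u: "u \<in> V - F" for u
  proof -
    obtain j where "received_from (U - F) (READY a) (s j u)"
      using eventually_received_from[OF large(1) _ u] U(2) by blast
    then have "\<not> ready (s j u) \<Longrightarrow> guard V \<Q> \<B> c On_Ready_Nonfaulty a (s j u)"
      using large \<open>U - F \<noteq> {}\<close> by (auto intro!: exI[of _ "U - F"])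
    then show ?thesis using eventually_flag[OF u, of On_Ready_Nonfaulty j a] by simp
  qed
  then show "\<exists>j a'. delivers act j v' a'" using all_ready_imp_all_deliver v' by blast
qed

end

theorem theorem3:
  fixes C V F :: "'n set" and c :: 'n
    and \<Q> \<B> :: "'n set set"
    and s :: "nat \<Rightarrow> ('n, 'v) config" and act :: "nat \<Rightarrow> ('n, 'v) action"
  assumes "C \<inter> V = {}" and "finite V" and "V \<noteq> {}" and "c \<in> C" and "F \<subseteq> C \<union> V"
    and "dissemination_quorum_system V \<Q> \<B>"
    and "bracha_execution C V \<Q> \<B> c F s act"
    and "\<exists>B\<in>\<B>. F \<inter> V \<subseteq> B"
  shows "reliable_byzantine_broadcast V c F (broadcasts act) (delivers act)"
proof -
  obtain B where "B \<in> \<B>" "F \<inter> V \<subseteq> B" using assms(8) by blast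
  with assms interpret bracha C V F B c \<Q> \<B> s act by unfold_locales
  show ?thesis
    unfolding reliable_byzantine_broadcast_def
    using validity no_duplication integrity consistency totality by blast
qed

end
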